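(* Suppose $X$ is a complete metric space, $A$ and $B$ are closed subsets of $X$, $a\in A$, $b\in B$, and $\varepsilon>0$. If $$d(a,b)<d(A,B)+\varepsilon,$$ then, for any $\lambda,\rho>0$, there exist $\hat a\in A\cap B_\lambda(a)$ and $\hat b\in B\cap B_\rho(b)$ such that (i) $d(\hat a,\hat b)\le d(a,b)$; (ii) $d\big(A\cap B_{\xi\lambda}(\hat a),\,B\cap B_{\xi\rho}(\hat b)\big)+\xi\varepsilon>d(\hat a,\hat b)$ for all $\xi>0$.
   Context: $d(\cdot,\cdot)$ is the metric of $X$; $B_\delta(x)$ (with subscript) denotes the open ball with centre $x$ and radius $\delta>0$ (not to be confused with the set $B$). For nonempty subsets $A,B\subset X$, $d(A,B):=\inf_{a\in A,\,b\in B}d(a,b)$. *)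

theory Defs
  imports "HOL-Analysis.Analysis"
begin

end

(* The pair (a, b) is moved inside A \<times> B by Ekeland's variational principle, applied to the distance
   function with the perturbation \<delta> max (d(x, x') / \<lambda>) (d(y, y') / \<rho>). Taking \<delta> strictly between
   d(a, b) - d(A, B) and \<epsilon> absorbs the loss of strictness when passing to the infimum in (ii). *)
theory Submission
  imports Defs
begin

text \<open>The reason is an ordering argument: iterated near-minimisation of \<open>f\<close> below
  the current point yields a Cauchy sequence, and nothing but its limit lies below the limit.
  \<open>D\<close> is kept separate from \<open>dist\<close> so that a weighted perturbation can be
  used; \<open>K\<close> transfers smallness in \<open>D\<close> to the metric in which completeness
  is available.\<close>

theorem Ekeland_variational_principle:
  fixes S :: "'c::complete_space set" and f :: "'c \<Rightarrow> real" and D :: "'c \<Rightarrow> 'c \<Rightarrow> real"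
  assumes lsc: "\<And>c. closed {v \<in> S. f v \<le> c}"
    and bdd: "bdd_below (f ` S)"
    and D_refl: "\<And>x. D x x = 0"
    and D_triangle: "\<And>x y z. D x z \<le> D x y + D y z"
    and D_cont: "\<And>x. continuous_on UNIV (\<lambda>y. D y x)"
    and D_dist: "\<And>x y. dist x y \<le> K * D x y"
    and K: "K \<ge> 0"
    and u: "u \<in> S"
  obtains w where "w \<in> S" "f w + D w u \<le> f u"
    "\<And>v. v \<in> S \<Longrightarrow> v \<noteq> w \<Longrightarrow> f w < f v + D v w"
proof -
  \<comment> \<open>\<open>T x\<close> is the lower set of \<open>x\<close> in the Ekeland order.
    Reflexivity comes from \<open>D_refl\<close>, transitivity from
    \<open>D_triangle\<close>.\<close>
  define T where "T x = {v \<in> S. f v + D v x \<le> f x}" for x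
  have T_self: "x \<in> T x" if "x \<in> S" for x
    using that by (simp add: T_def D_refl)
  have T_trans: "z \<in> T x" if "z \<in> T y" "y \<in> T x" for x y z
    using that D_triangle[of z x y] by (auto simp: T_def)
  have step: "\<exists>y. y \<in> S \<and> y \<in> T x \<and> (\<forall>v\<in>T x. f y \<le> f v + (1/2) ^ n)"
    if x: "x \<in> S" for x n
  proof -
    have ne: "f ` T x \<noteq> {}" and bd: "bdd_below (f ` T x)"
      using T_self[OF x] by (auto simp: T_def intro: bdd_below_mono[OF bdd])
    have "Inf (f ` T x) < Inf (f ` T x) + (1/2) ^ n" by simp
    then obtain y where y: "y \<in> T x" "f y < Inf (f ` T x) + (1/2) ^ n"
      using cInf_lessD[OF ne] by blast
    have "f y \<le> f v + (1/2) ^ n" if "v \<in> T x" for v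
      using cInf_lower[OF imageI[OF that] bd] y(2) by linarith
    then show ?thesis using y(1) by (auto simp: T_def)
  qed
  \<comment> \<open>Dependent choice of a descending sequence from \<open>u\<close>; the tolerances
    \<open>(1/2) ^ n\<close> tend to 0, since the infimum over \<open>T (X n)\<close> may not be
    attained.\<close>
  have "\<exists>X. \<forall>n. (X n \<in> S \<and> (n = 0 \<longrightarrow> X n = u)) \<and>
      (X (Suc n) \<in> T (X n) \<and> (\<forall>v\<in>T (X n). f (X (Suc n)) \<le> f v + (1/2) ^ n))"
    by (rule dependent_nat_choice) (use u step in auto)
  then obtain X where X_S: "\<And>n. X n \<in> S" and X_0: "X 0 = u"
    and X_Suc: "\<And>n. X (Suc n) \<in> T (X n)"
    and X_min: "\<And>n v. v \<in> T (X n) \<Longrightarrow> f (X (Suc n)) \<le> f v + (1/2) ^ n"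
    by metis
  have X_T: "X m \<in> T (X n)" if "n \<le> m" for m n
    using that by (induction rule: dec_induct) (use T_self X_S T_trans X_Suc in blast)+
  \<comment> \<open>For K > 0 the sign comes from \<open>D_dist\<close>; for K = 0 that bound forces
    x = y, and \<open>D_refl\<close> applies.\<close>
  have D_nonneg: "0 \<le> D x y" for x y
    using D_triangle[of x x y] D_dist[of x y] K D_refl[of x]
    by (smt (verit) mult_nonneg_nonpos mult_pos_neg zero_le_dist zero_less_dist_iff mult_eq_0_iff)
  have X_mono: "f (X m) \<le> f (X n)" if "n \<le> m" for m n
    using X_T[OF that] D_nonneg[of "X m" "X n"] by (simp add: T_def)
  obtain c where c: "\<And>n. c \<le> f (X n)"
    using bdd X_S by (auto simp: bdd_below_def)
  obtain L where lim: "(\<lambda>n. f (X n)) \<longlonglongrightarrow> L" and L: "\<And>n. L \<le> f (X n)"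
    using decseq_convergent[of "\<lambda>n. f (X n)" c] c X_mono by (auto simp: decseq_def)
  have D_X: "D (X m) (X n) \<le> f (X n) - L" if "n \<le> m" for m n
    using X_T[OF that] L[of m] by (simp add: T_def)
  have "Cauchy X"
  proof (rule metric_CauchyI)
    fix e :: real assume "e > 0"
    have "(\<lambda>n. K * (f (X n) - L)) \<longlonglongrightarrow> K * (L - L)"
      by (intro tendsto_intros lim)
    then have "\<forall>\<^sub>F n in sequentially. K * (f (X n) - L) < e / 2"
      by (rule order_tendstoD) (use \<open>e > 0\<close> in simp)
    then obtain N where N: "K * (f (X N) - L) < e / 2"
      by (auto simp: eventually_sequentially)
    have "dist (X m) (X N) < e / 2" if "N \<le> m" for m
      using D_dist[of "X m" "X N"] mult_left_mono[OF D_X[OF that] K] N by linarith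
    then show "\<exists>M. \<forall>m\<ge>M. \<forall>n\<ge>M. dist (X m) (X n) < e"
      by (metis dist_triangle_half_l dist_commute)
  qed
  then obtain w where w: "X \<longlonglongrightarrow> w"
    by (auto simp: Cauchy_convergent_iff convergent_def)
  \<comment> \<open>The tail of \<open>X\<close> stays in one closed sublevel set, which gives
    membership in \<open>S\<close> and the bound on \<open>f w\<close> together.\<close>
  have w_le: "w \<in> S \<and> f w \<le> f (X n)" for n
  proof -
    have "w \<in> {v \<in> S. f v \<le> f (X n)}"
      by (rule Lim_in_closed_set[OF lsc _ sequentially_bot w])
        (auto simp: eventually_sequentially X_S intro!: exI[of _ n] X_mono)
    then show ?thesis by simp
  qed
  have w_L: "f w \<le> L"
    using LIMSEQ_le_const[OF lim] w_le by blast
  have w_T: "w \<in> T (X n)" for n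
  proof -
    have "(\<lambda>m. D (X m) (X n)) \<longlonglongrightarrow> D w (X n)"
      using continuous_on_tendsto_compose[OF D_cont w] by simp
    then have "D w (X n) \<le> f (X n) - L"
      by (rule LIMSEQ_le_const2) (use D_X in blast)
    then show ?thesis using w_le w_L by (simp add: T_def)
  qed
  \<comment> \<open>A violating \<open>v\<close> is in \<open>T w\<close>, hence by transitivity in
    every \<open>T (X n)\<close>. Near-minimality then gives f w \<le> f v in the limit, so D v w
    \<le> 0 and v = w.\<close>
  have strict: "f w < f v + D v w" if v: "v \<in> S" "v \<noteq> w" for v
  proof (rule ccontr)
    assume "\<not> ?thesis"
    then have vw: "v \<in> T w" using v by (simp add: T_def)
    have "f w \<le> f v + (1/2) ^ n" for n
      using X_min[OF T_trans[OF vw w_T[of n]]] w_le[of "Suc n"] by linarith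
    moreover have "(\<lambda>n. f v + (1/2) ^ n) \<longlonglongrightarrow> f v + 0"
      by (intro tendsto_intros) simp
    ultimately have "f w \<le> f v"
      by (metis LIMSEQ_le_const add_0_right)
    then have "K * D v w \<le> 0"
      using vw K by (simp add: T_def mult_nonneg_nonpos)
    then show False using D_dist[of v w] v(2) by (metis dist_le_zero_iff order_trans)
  qed
  show thesis
    by (rule that) (use w_le w_T[of 0] X_0 strict in \<open>auto simp: T_def\<close>)
qed

theorem mainTheorem2:
  fixes A B :: "'a::complete_space set" and a b :: 'a and \<epsilon> :: real
  assumes "closed A" and "closed B"
    and "a \<in> A" and "b \<in> B"
    and "\<epsilon> > 0"
    and "dist a b < setdist A B + \<epsilon>"
  shows "\<forall>l r :: real. l > 0 \<longrightarrow> r > 0 \<longrightarrow>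
    (\<exists>a' \<in> A \<inter> ball a l. \<exists>b' \<in> B \<inter> ball b r.
       dist a' b' \<le> dist a b \<and>
       (\<forall>\<xi>::real. \<xi> > 0 \<longrightarrow>
          setdist (A \<inter> ball a' (\<xi> * l)) (B \<inter> ball b' (\<xi> * r)) + \<xi> * \<epsilon> > dist a' b'))"
proof (intro allI impI)
  fix l r :: real assume l: "l > 0" and r: "r > 0"
  obtain \<delta> where \<delta>: "dist a b - setdist A B < \<delta>" "\<delta> < \<epsilon>"
    using dense[of "dist a b - setdist A B" \<epsilon>] assms(6) by auto
  have \<delta>_pos: "\<delta> > 0"
    using setdist_le_dist[OF assms(3,4)] \<delta>(1) by linarith
  define f :: "'a \<times> 'a \<Rightarrow> real" where "f p = dist (fst p) (snd p)" for p
  define D :: "'a \<times> 'a \<Rightarrow> 'a \<times> 'a \<Rightarrow> real"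
    where "D p q = \<delta> * max (dist (fst p) (fst q) / l) (dist (snd p) (snd q) / r)" for p q
  have lsc: "closed {p \<in> A \<times> B. f p \<le> c}" for c
  proof -
    have "closed (A \<times> B \<inter> {p. f p \<le> c})"
      unfolding f_def using assms(1,2)
      by (intro closed_Int closed_Times closed_Collect_le continuous_intros)
    then show ?thesis by (simp add: Int_def)
  qed
  have bdd: "bdd_below (f ` (A \<times> B))"
    by (auto simp: f_def bdd_below_def intro: exI[of _ 0])
  have D_refl: "D p p = 0" for p
    by (simp add: D_def)
  have D_triangle: "D p s \<le> D p q + D q s" for p q s
  proof -
    have "dist (fst p) (fst s) / l \<le> dist (fst p) (fst q) / l + dist (fst q) (fst s) / l"
      "dist (snd p) (snd s) / r \<le> dist (snd p) (snd q) / r + dist (snd q) (snd s) / r"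
      using l r by (simp_all add: dist_triangle divide_right_mono flip: add_divide_distrib)
    then show ?thesis
      unfolding D_def distrib_left[symmetric]
      by (intro mult_left_mono) (use \<delta>_pos in auto)
  qed
  have D_cont: "continuous_on UNIV (\<lambda>q. D q p)" for p
    unfolding D_def using l r by (intro continuous_intros) auto
  \<comment> \<open>The Euclidean product distance is at most the sum of the coordinate distances,
    hence at most \<open>(l + r) * M\<close>, while \<open>D p q\<close> is
    \<open>\<delta> * M\<close>.\<close>
  have D_dist: "dist p q \<le> ((l + r) / \<delta>) * D p q" for p q
  proof -
    define M where "M = max (dist (fst p) (fst q) / l) (dist (snd p) (snd q) / r)"
    have "dist (fst p) (fst q) \<le> l * M" "dist (snd p) (snd q) \<le> r * M"
      using l r by (simp_all add: M_def le_max_iff_disj mult.commute[of l] mult.commute[of r] flip: pos_divide_le_eq)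
    moreover have "dist p q \<le> dist (fst p) (fst q) + dist (snd p) (snd q)"
      by (simp add: dist_prod_def sqrt_sum_squares_le_sum)
    moreover have "((l + r) / \<delta>) * D p q = l * M + r * M"
      using \<delta>_pos by (simp add: D_def M_def[symmetric] field_simps)
    ultimately show ?thesis by linarith
  qed
  obtain w where w: "w \<in> A \<times> B" "f w + D w (a, b) \<le> f (a, b)"
    and w_min: "\<And>v. v \<in> A \<times> B \<Longrightarrow> v \<noteq> w \<Longrightarrow> f w < f v + D v w"
    by (rule Ekeland_variational_principle[OF lsc bdd D_refl D_triangle D_cont D_dist])
      (use l r \<delta>_pos assms(3,4) in auto)
  obtain a' b' where w_eq: "w = (a', b')" and a': "a' \<in> A" and b': "b' \<in> B"
    using w(1) by auto
  \<comment> \<open>Balls for \<open>D\<close> are products of balls whose radii have ratio l : r.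
    The case c = 1 locates \<open>w\<close> near \<open>(a, b)\<close>; c = \<xi> serves
    (ii).\<close>
  have D_less: "D (x, y) (x', y') < \<delta> * c \<longleftrightarrow> dist x x' < c * l \<and> dist y y' < c * r" for x y x' y' c
    using l r \<delta>_pos by (simp add: D_def pos_divide_less_eq)
  \<comment> \<open>Since \<open>f w\<close> is at least \<open>setdist A B\<close>, the decrease of
    \<open>f\<close> from \<open>(a, b)\<close> to \<open>w\<close>, which bounds
    \<open>D w (a, b)\<close>, is below \<delta>.\<close>
  have "D w (a, b) < \<delta> * 1"
    using w(2) setdist_le_dist[OF a' b'] \<delta>(1) by (simp add: f_def w_eq)
  then have near: "a' \<in> ball a l" "b' \<in> ball b r"
    unfolding w_eq D_less by (simp_all add: dist_commute)
  have "0 \<le> D w (a, b)"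
    using l \<delta>_pos by (simp add: D_def le_max_iff_disj)
  then have closer: "dist a' b' \<le> dist a b"
    using w(2) by (simp add: f_def w_eq)
  have "dist a' b' < setdist (A \<inter> ball a' (\<xi> * l)) (B \<inter> ball b' (\<xi> * r)) + \<xi> * \<epsilon>"
    if \<xi>: "\<xi> > 0" for \<xi>
  proof -
    have "dist a' b' - \<delta> * \<xi> \<le> setdist (A \<inter> ball a' (\<xi> * l)) (B \<inter> ball b' (\<xi> * r))"
    proof (rule le_setdistI)
      \<comment> \<open>Nonemptiness matters because \<open>setdist\<close> takes the value 0 on an
        empty set; the centres are witnesses.\<close>
      show "A \<inter> ball a' (\<xi> * l) \<noteq> {}" "B \<inter> ball b' (\<xi> * r) \<noteq> {}"
        using a' b' \<xi> l r by (metis IntI centre_in_ball empty_iff mult_pos_pos)+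
      fix x y assume xy: "x \<in> A \<inter> ball a' (\<xi> * l)" "y \<in> B \<inter> ball b' (\<xi> * r)"
      have "D (x, y) w < \<delta> * \<xi>"
        unfolding w_eq D_less using xy by (simp add: dist_commute)
      \<comment> \<open>The strict inequality covers only points other than \<open>w\<close>; at
        \<open>w\<close> itself equality holds, as \<open>D w w\<close> is 0.\<close>
      moreover have "f w \<le> f (x, y) + D (x, y) w"
        using w_min[of "(x, y)"] xy D_refl[of w] by (cases "(x, y) = w") auto
      ultimately show "dist a' b' - \<delta> * \<xi> \<le> dist x y"
        by (simp add: f_def w_eq)
    qed
    moreover have "\<delta> * \<xi> < \<xi> * \<epsilon>"
      using \<delta>(2) \<xi> by (simp add: mult.commute)
    ultimately show ?thesis by linarith
  qed
  then show "\<exists>a' \<in> A \<inter> ball a l. \<exists>b' \<in> B \<inter> ball b r.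
       dist a' b' \<le> dist a b \<and>
       (\<forall>\<xi>::real. \<xi> > 0 \<longrightarrow>
          setdist (A \<inter> ball a' (\<xi> * l)) (B \<inter> ball b' (\<xi> * r)) + \<xi> * \<epsilon> > dist a' b')"
    using a' b' near closer by blast
qed

end
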